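(* Let $q\in\mathbb R$, $\Delta>0$, $\varepsilon>0$, let $s\ne s'$ be two discrete states, let $a$ be an action, and let the safety predicate on returns with one-dimensional continuous part $x\in\mathbb R$ satisfy $$\operatorname{Safe}((s,x),a)=1\iff x\le q,\qquad \operatorname{Safe}((s',x),a)=1\iff x\le q-\Delta .$$ Take the discrete neighborhood of $s$ to be $\{s,s'\}$. Then for $x\in\mathbb R$ the following three conditions (i) $\operatorname{Safe}((s,x'),a)=1$ for all $x'$ with $|x'-x|\le\varepsilon$; (ii) $\operatorname{Safe}((t,x),a)=1$ for all $t\in\{s,s'\}$; (iii) $\operatorname{Safe}((t,x'),a)=0$ for some $t\in\{s,s'\}$ and some $x'$ with $|x'-x|\le\varepsilon$ hold simultaneously if and only if $$x\in\bigl(q-\Delta-\varepsilon,\ \min(q-\varepsilon,\,q-\Delta)\bigr],$$ and this interval has length $\min(\Delta,\varepsilon)$.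
   Context: A typed return is a pair $(s,x)$ with $s$ a discrete state and $x$ a real number; $\operatorname{Safe}((s,x),a)\in\{0,1\}$ is the safety predicate for action $a$ ($1$ = safe). *)

theory Defs
  imports "HOL-Analysis.Analysis"
begin

type_synonym 's typed_return = "'s \<times> real"

end

theory Submission
  imports Defs
begin

text \<open>For the fixed action, the safe set at each state is a ray unbounded to the left, so the
  worst perturbation of \<open>x\<close> within radius \<epsilon> is \<open>x + \<epsilon>\<close>;
  since \<Delta> > 0, the worse of the two states is \<open>s'\<close>. Each condition thus
  collapses to one linear inequality in \<open>x\<close> (\<open>robust\<close>,
  \<open>pointwise\<close>, \<open>joint\<close>): two upper bounds and one strict lower bound,
  which intersect in the half-open interval. Its right end is q - max \<epsilon> \<Delta>, and
  \<Delta> + \<epsilon> - max \<epsilon> \<Delta> = min \<Delta> \<epsilon>.\<close>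

theorem mainTheorem2:
  fixes q \<Delta> \<epsilon> :: real
    and s s' :: 's
    and a :: 'act
    and Safe :: "'s typed_return \<Rightarrow> 'act \<Rightarrow> bool"
    and nbhd :: "'s \<Rightarrow> 's set"
  assumes "\<Delta> > 0" and "\<epsilon> > 0" and "s \<noteq> s'"
    and "\<And>x. Safe (s, x) a \<longleftrightarrow> x \<le> q"
    and "\<And>x. Safe (s', x) a \<longleftrightarrow> x \<le> q - \<Delta>"
    and "nbhd s = {s, s'}"
  shows "(\<forall>x::real.
            ((\<forall>x'. \<bar>x' - x\<bar> \<le> \<epsilon> \<longrightarrow> Safe (s, x') a) \<and>
             (\<forall>t\<in>nbhd s. Safe (t, x) a) \<and>
             (\<exists>t\<in>nbhd s. \<exists>x'. \<bar>x' - x\<bar> \<le> \<epsilon> \<and> \<not> Safe (t, x') a))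
            \<longleftrightarrow> x \<in> {q - \<Delta> - \<epsilon> <.. min (q - \<epsilon>) (q - \<Delta>)})
         \<and> measure lborel {q - \<Delta> - \<epsilon> <.. min (q - \<epsilon>) (q - \<Delta>)} = min \<Delta> \<epsilon>"
proof (intro conjI allI)
  fix x :: real
  have robust: "(\<forall>x'. \<bar>x' - x\<bar> \<le> \<epsilon> \<longrightarrow> Safe (s, x') a) \<longleftrightarrow> x \<le> q - \<epsilon>"
  proof
    assume "\<forall>x'. \<bar>x' - x\<bar> \<le> \<epsilon> \<longrightarrow> Safe (s, x') a"
    then have "Safe (s, x + \<epsilon>) a"
      using assms(2) by simp
    then show "x \<le> q - \<epsilon>"
      using assms(4) by simp
  next
    assume "x \<le> q - \<epsilon>"
    then show "\<forall>x'. \<bar>x' - x\<bar> \<le> \<epsilon> \<longrightarrow> Safe (s, x') a"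
      unfolding assms(4) by (auto simp: abs_le_iff)
  qed
  have pointwise: "(\<forall>t\<in>nbhd s. Safe (t, x) a) \<longleftrightarrow> x \<le> q - \<Delta>"
    \<comment> \<open>Positivity of \<Delta> makes the bound at \<open>s'\<close> imply the one at
      \<open>s\<close>.\<close>
    using assms(1) by (auto simp: assms(4-6))
  have joint: "(\<exists>t\<in>nbhd s. \<exists>x'. \<bar>x' - x\<bar> \<le> \<epsilon> \<and> \<not> Safe (t, x') a) \<longleftrightarrow> q - \<Delta> - \<epsilon> < x"
  proof
    assume "\<exists>t\<in>nbhd s. \<exists>x'. \<bar>x' - x\<bar> \<le> \<epsilon> \<and> \<not> Safe (t, x') a"
    then obtain t x' where "t \<in> {s, s'}" "\<bar>x' - x\<bar> \<le> \<epsilon>" "\<not> Safe (t, x') a"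
      using assms(6) by auto
    \<comment> \<open>A failure at \<open>s'\<close> gives the bound directly; a failure at
      \<open>s\<close> gives q - \<epsilon> < x, which is stronger because \<Delta> > 0.\<close>
    then show "q - \<Delta> - \<epsilon> < x"
      using assms(1) by (auto simp: assms(4,5) abs_le_iff)
  next
    assume "q - \<Delta> - \<epsilon> < x"
    \<comment> \<open>The witness takes both worst choices at once: the stricter state and the right
      end of the perturbation range.\<close>
    then have "\<not> Safe (s', x + \<epsilon>) a"
      using assms(5) by simp
    moreover have "\<bar>(x + \<epsilon>) - x\<bar> \<le> \<epsilon>" and "s' \<in> nbhd s"
      using assms(2,6) by auto
    ultimately show "\<exists>t\<in>nbhd s. \<exists>x'. \<bar>x' - x\<bar> \<le> \<epsilon> \<and> \<not> Safe (t, x') a"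
      by blast
  qed
  show "((\<forall>x'. \<bar>x' - x\<bar> \<le> \<epsilon> \<longrightarrow> Safe (s, x') a) \<and>
         (\<forall>t\<in>nbhd s. Safe (t, x) a) \<and>
         (\<exists>t\<in>nbhd s. \<exists>x'. \<bar>x' - x\<bar> \<le> \<epsilon> \<and> \<not> Safe (t, x') a))
        \<longleftrightarrow> x \<in> {q - \<Delta> - \<epsilon> <.. min (q - \<epsilon>) (q - \<Delta>)}"
    unfolding robust pointwise joint by auto
next
  \<comment> \<open>The endpoints must be in order for the measure to equal their difference; a
    reversed interval would be empty and have measure 0.\<close>
  have "q - \<Delta> - \<epsilon> \<le> min (q - \<epsilon>) (q - \<Delta>)"
    using assms(1,2) by simp
  then show "measure lborel {q - \<Delta> - \<epsilon> <.. min (q - \<epsilon>) (q - \<Delta>)} = min \<Delta> \<epsilon>"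
    by (simp add: min_def)
qed

end
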